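(* Let $t,d,s,T$ be positive integers, where $(t,d,s)$ are the partition parameters and $T$ is the security parameter of the root-of-unity scheme (defined in the context). (1) If $t=d=1$ (inner product partition), then the recovery threshold of the root-of-unity scheme is $s+2T$: run with $N=s+2T$ servers, the scheme is decodable and $T$-secure. This equals the recovery threshold of the discrete-Fourier-transform scheme of Mital, Ling and Gündüz without pre-computation. (2) If $s=1$ (outer product partition), then the recovery threshold of the root-of-unity scheme is $(d+1)(t+T)-1$: run with $N=(d+1)(t+T)-1$ servers, the scheme is decodable and $T$-secure. When $T<t$ this equals the recovery threshold of GASP codes.
   Context: Setting (secure distributed matrix multiplication): a user holds $A\in\mathbb{F}_q^{a\times b}$ and $B\in\mathbb{F}_q^{b\times c}$, with $t\mid a$, $s\mid b$, $d\mid c$, and wants $AB$ with the help of $N$ honest-but-curious servers, any $T$ of which may collude. It is assumed that $N\mid(q-1)$, and $\alpha_N\in\mathbb{F}_q$ denotes an $N$-th primitive root of unity. Grid partition: $A=[A_{i,j}]_{1\le i\le t,\,1\le j\le s}$ with blocks $A_{i,j}\in\mathbb{F}_q^{\frac at\times\frac bs}$, and $B=[B_{i,j}]_{1\le i\le s,\,1\le j\le d}$ with blocks $B_{i,j}\in\mathbb{F}_q^{\frac bs\times\frac cd}$, so that $AB=\left[\sum_{\ell=1}^s A_{i,\ell}B_{\ell,j}\right]_{1\le i\le t,\,1\le j\le d}$. Root-of-unity scheme: the user chooses $R_1,\dots,R_T\in\mathbb{F}_q^{\frac at\times\frac bs}$ and $S_1,\dots,S_T\in\mathbb{F}_q^{\frac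 bs\times\frac cd}$ independently and uniformly at random (and independently of $A,B$), and forms the Laurent polynomials with matrix coefficients $$f_A(x)=\sum_{i=1}^t\sum_{j=1}^s A_{i,j}\,x^{(i-1)s+j-1}+\sum_{k=1}^T R_k\,x^{ts+k-1},$$ $$f_B(x)=\sum_{i=1}^s\sum_{j=1}^d B_{i,j}\,x^{(1-j)(ts+T)+(1-i)}+\sum_{k=1}^T S_k\,x^{-d(ts+T)-k+1}.$$ For $i=1,\dots,N$ the user uploads $f_A(\alpha_N^i)$ and $f_B(\alpha_N^i)$ to Server $i$; Server $i$ computes $f_A(\alpha_N^i)f_B(\alpha_N^i)$ and sends this matrix back to the user. The number of servers used by the scheme is $$N=\begin{cases}(d+1)(t+T)-1, & \text{if } s=1,\\ dst+dT+ts-s+T, & \text{if } s>1.\end{cases}$$ The recovery threshold (also called recovery rate) of the scheme is this number $N$ of servers, with whose assistance it securely computes $AB$. Decodable: for all $A,B$ and all values of the $R_k,S_k$, the product $AB$ is a function of the $N$ responses $f_A(\alpha_N^i)f_B(\alpha_N^i)$, $1\le i\le N$. $T$-secure: when $A,B$ are regarded as random matrices, for every set $\mathcal{T}\subseteq\{1,\dots,N\}$ with $|\mathcal{T}|=T$, the mutual information $I\big(A,B;\,(f_A(\alpha_N^i),f_B(\alpha_N^i))_{i\in\mathcal{T}}\big)$ is $0$. Benchmarks (known values, to be taken as given): the discrete-Fourier-transform scheme of Mital, Ling and Gündüz, for the inner product partition into $s$ blocks without pre-computation, has recovery threshold $s+2T$; GASP codes, for the outer product partition with parameters $(t,d)$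 and $T<t$, have recovery threshold $(d+1)(t+T)-1$. *)

theory Defs
  imports "HOL-Probability.Probability" "Jordan_Normal_Form.Matrix"
begin

definition primitive_root_of_unity :: "nat \<Rightarrow> 'f::field \<Rightarrow> bool" where
  "primitive_root_of_unity N \<alpha> \<longleftrightarrow> 0 < N \<and> \<alpha> ^ N = 1 \<and> (\<forall>k. 0 < k \<and> k < N \<longrightarrow> \<alpha> ^ k \<noteq> 1)"

(* Block (i, j), counted from 1, of M partitioned into a p x q grid of equal blocks;
   matrix entries themselves are indexed from 0. *)
definition grid_block :: "nat \<Rightarrow> nat \<Rightarrow> 'f mat \<Rightarrow> nat \<Rightarrow> nat \<Rightarrow> 'f mat" where
  "grid_block p q M i j =
     (let h = dim_row M div p; w = dim_col M div q
      in mat h w (\<lambda>(u, v). M $$ ((i - 1) * h + u, (j - 1) * w + v)))"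

(* Values at x of the two Laurent polynomials with matrix coefficients, written entrywise.
   The exponents are integers, so the differences in them do not truncate. *)
definition f_A :: "nat \<Rightarrow> nat \<Rightarrow> nat \<Rightarrow> 'f::field mat \<Rightarrow> (nat \<Rightarrow> 'f mat) \<Rightarrow> 'f \<Rightarrow> 'f mat" where
  "f_A t s T A R x =
     mat (dim_row A div t) (dim_col A div s) (\<lambda>(u, v).
       (\<Sum>i=1..t. \<Sum>j=1..s.
          grid_block t s A i j $$ (u, v) * x powi ((int i - 1) * int s + int j - 1))
     + (\<Sum>k=1..T. R k $$ (u, v) * x powi (int t * int s + int k - 1)))"

definition f_B :: "nat \<Rightarrow> nat \<Rightarrow> nat \<Rightarrow> nat \<Rightarrow> 'f::field mat \<Rightarrow> (nat \<Rightarrow> 'f mat) \<Rightarrow> 'f \<Rightarrow> 'f mat" where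
  "f_B t s d T B S x =
     mat (dim_row B div s) (dim_col B div d) (\<lambda>(u, v).
       (\<Sum>i=1..s. \<Sum>j=1..d.
          grid_block s d B i j $$ (u, v)
            * x powi ((1 - int j) * (int t * int s + int T) + (1 - int i)))
     + (\<Sum>k=1..T. S k $$ (u, v)
            * x powi (- int d * (int t * int s + int T) - int k + 1)))"

definition rou_recovery_threshold :: "nat \<Rightarrow> nat \<Rightarrow> nat \<Rightarrow> nat \<Rightarrow> nat" where
  "rou_recovery_threshold t s d T =
     (if s = 1 then (d + 1) * (t + T) - 1
      else d * s * t + d * T + t * s - s + T)"

(* The decoder may depend on the dimensions, the parameters and \<alpha>, but not on A, B, R, S. *)
definition rou_decodable ::
  "nat \<Rightarrow> nat \<Rightarrow> nat \<Rightarrow> nat \<Rightarrow> nat \<Rightarrow> nat \<Rightarrow> nat \<Rightarrow> nat \<Rightarrow> 'f::field \<Rightarrow> bool" where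
  "rou_decodable a b c t s d T N \<alpha> \<longleftrightarrow>
     (\<exists>dec :: 'f mat list \<Rightarrow> 'f mat.
        \<forall>A \<in> carrier_mat a b. \<forall>B \<in> carrier_mat b c. \<forall>R S.
          (\<forall>k\<in>{1..T}. R k \<in> carrier_mat (a div t) (b div s)) \<longrightarrow>
          (\<forall>k\<in>{1..T}. S k \<in> carrier_mat (b div s) (c div d)) \<longrightarrow>
          A * B = dec (map (\<lambda>i. f_A t s T A R (\<alpha> ^ i) * f_B t s d T B S (\<alpha> ^ i)) [1..<N + 1]))"

(* T independent uniform m x n matrices, indexed by 1, ..., T *)
definition uniform_masks :: "nat \<Rightarrow> nat \<Rightarrow> nat \<Rightarrow> (nat \<Rightarrow> 'f::{field,finite} mat) pmf" where
  "uniform_masks T m n = Pi_pmf {1..T} undefined (\<lambda>_. pmf_of_set (carrier_mat m n))"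

(* Joint law of ((A, B), (R, S)), where P is the law of (A, B) *)
definition rou_experiment ::
  "nat \<Rightarrow> nat \<Rightarrow> nat \<Rightarrow> nat \<Rightarrow> nat \<Rightarrow> nat \<Rightarrow> nat
   \<Rightarrow> ('f::{field,finite} mat \<times> 'f mat) pmf
   \<Rightarrow> (('f mat \<times> 'f mat) \<times> ((nat \<Rightarrow> 'f mat) \<times> (nat \<Rightarrow> 'f mat))) pmf" where
  "rou_experiment a b c t s d T P =
     pair_pmf P (pair_pmf (uniform_masks T (a div t) (b div s))
                          (uniform_masks T (b div s) (c div d)))"

(* Mutual information in bits of two functions of a discrete outcome *)
definition pmf_mutual_information :: "'w pmf \<Rightarrow> ('w \<Rightarrow> 'x) \<Rightarrow> ('w \<Rightarrow> 'y) \<Rightarrow> real" where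
  "pmf_mutual_information p X Y =
     prob_space.mutual_information (measure_pmf p) 2
       (count_space (range X)) (count_space (range Y)) X Y"

(* A and B may be arbitrarily distributed and arbitrarily correlated. *)
definition rou_secure ::
  "nat \<Rightarrow> nat \<Rightarrow> nat \<Rightarrow> nat \<Rightarrow> nat \<Rightarrow> nat \<Rightarrow> nat \<Rightarrow> nat \<Rightarrow> 'f::{field,finite} \<Rightarrow> bool" where
  "rou_secure a b c t s d T N \<alpha> \<longleftrightarrow>
     (\<forall>P :: ('f mat \<times> 'f mat) pmf. set_pmf P \<subseteq> carrier_mat a b \<times> carrier_mat b c \<longrightarrow>
       (\<forall>C \<subseteq> {1..N}. card C = T \<longrightarrow>
         pmf_mutual_information (rou_experiment a b c t s d T P)
           (\<lambda>((A, B), (R, S)). (A, B))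
           (\<lambda>((A, B), (R, S)). \<lambda>i\<in>C. (f_A t s T A R (\<alpha> ^ i), f_B t s d T B S (\<alpha> ^ i))) = 0))"

(* Published recovery threshold of the discrete-Fourier-transform scheme of Mital, Ling
   and Gunduz, without pre-computation, for the inner product partition into s blocks *)
definition dft_recovery_threshold :: "nat \<Rightarrow> nat \<Rightarrow> nat" where
  "dft_recovery_threshold s T = s + 2 * T"

(* Published recovery threshold of GASP codes for the outer product partition (t, d);
   this value is for T < t, and nothing is claimed about T \<ge> t. *)
definition gasp_recovery_threshold :: "nat \<Rightarrow> nat \<Rightarrow> nat \<Rightarrow> nat" where
  "gasp_recovery_threshold t d T = (if T < t then (d + 1) * (t + T) - 1 else undefined)"

end

theory Submission
  imports Defs
begin

text \<open>
  Put \<open>M = t s + T\<close>. For all partition parameters the number of servers is \<open>N = (d + 1) M - s\<close>,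
  which in both special cases is the claimed value, so decodability and security are proved for
  general \<open>(t, d, s)\<close>.

  The block \<open>(i, j)\<close> of \<open>A B\<close> is the coefficient of \<open>f\<^sub>A f\<^sub>B\<close> at the exponent
  \<open>(i - 1) s - (j - 1) M\<close>. No other term of \<open>f\<^sub>A f\<^sub>B\<close> has an exponent congruent to this one
  modulo \<open>N\<close>, so the coefficient is read off by an inverse discrete Fourier transform of the
  \<open>N\<close> responses; \<open>N\<close> is invertible in the field because it divides \<open>q - 1\<close>.

  For fixed \<open>A\<close> and \<open>B\<close>, the map from the masks to the shares of \<open>T\<close> servers is an affine
  Vandermonde map, hence a bijection. The shares are therefore uniform whatever \<open>(A, B)\<close> is, that
  is, independent of \<open>(A, B)\<close>.
\<close>

section \<open>Orthogonality of the powers of a primitive root of unity\<close>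

lemma primitive_root_nonzero:
  fixes \<alpha> :: "'f::field"
  shows "primitive_root_of_unity N \<alpha> \<Longrightarrow> \<alpha> \<noteq> 0"
  by (auto simp: primitive_root_of_unity_def zero_power)

text \<open>Division with remainder reduces the exponent to some \<open>r\<close> with
  \<open>0 \<le> r < N\<close>, and primitivity excludes \<open>\<alpha> ^ r = 1\<close> unless
  \<open>r = 0\<close>.\<close>

lemma primitive_root_power_int_eq_1_iff:
  fixes \<alpha> :: "'f::field"
  assumes "primitive_root_of_unity N \<alpha>"
  shows "\<alpha> powi e = 1 \<longleftrightarrow> int N dvd e"
proof -
  have N: "0 < N" "\<alpha> ^ N = 1" "\<And>k. 0 < k \<Longrightarrow> k < N \<Longrightarrow> \<alpha> ^ k \<noteq> 1"
    using assms by (auto simp: primitive_root_of_unity_def)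
  have "\<alpha> \<noteq> 0" using assms by (rule primitive_root_nonzero)
  define r where "r = nat (e mod int N)"
  have r: "int r = e mod int N" "r < N" using N(1) by (auto simp: r_def nat_less_iff)
  have "e = int N * (e div int N) + int r" using r by simp
  then have "\<alpha> powi e = (\<alpha> powi int N) powi (e div int N) * \<alpha> powi int r"
    using \<open>\<alpha> \<noteq> 0\<close> by (metis power_int_add power_int_mult)
  then have "\<alpha> powi e = \<alpha> ^ r" using N(2) by simp
  moreover have "int N dvd e \<longleftrightarrow> r = 0" using r(1)[symmetric] by (simp add: dvd_eq_mod_eq_0)
  ultimately show ?thesis using N(3)[of r] r(2) by (cases "r = 0") auto
qed

text \<open>This is a geometric series in \<open>z = \<alpha> powi e\<close>. Since
  \<open>z ^ N = 1\<close>, it vanishes unless \<open>z = 1\<close>, and then every summand is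
  1.\<close>

lemma sum_primitive_root_power_int:
  fixes \<alpha> :: "'f::field"
  assumes "primitive_root_of_unity N \<alpha>"
  shows "(\<Sum>n=1..N. (\<alpha> ^ n) powi e) = (if int N dvd e then of_nat N else 0)"
proof -
  define z where "z = \<alpha> powi e"
  have \<alpha>: "\<alpha> ^ N = 1" "\<alpha> \<noteq> 0"
    using assms primitive_root_nonzero by (auto simp: primitive_root_of_unity_def)
  have pw: "(\<alpha> ^ n) powi e = z ^ n" for n
    unfolding z_def by (metis mult.commute power_int_mult power_int_of_nat)
  have zN: "z ^ N = 1" using pw[of N] \<alpha> by simp
  have z1: "z = 1 \<longleftrightarrow> int N dvd e"
    unfolding z_def by (rule primitive_root_power_int_eq_1_iff[OF assms])
  have "(\<Sum>n=1..N. z ^ n) = z * (\<Sum>n<N. z ^ n)"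
    by (simp add: sum_distrib_left sum.atLeast1_atMost_eq)
  moreover have "(z - 1) * (\<Sum>n<N. z ^ n) = 0"
    using zN by (simp add: power_diff_1_eq[symmetric])
  ultimately show ?thesis using z1 pw by auto
qed

text \<open>Translation by 1 permutes the field, so adding 1 to each summand leaves the sum of all
  elements unchanged.\<close>

lemma of_nat_CARD_eq_0: "of_nat CARD('f) = (0 :: 'f::{field,finite})"
proof -
  have "(\<Sum>x\<in>UNIV. x + 1) = (\<Sum>x\<in>UNIV. x :: 'f)"
    by (rule sum.reindex_bij_witness[of _ "\<lambda>x. x - 1" "\<lambda>x. x + 1"]) auto
  then show ?thesis by (simp add: sum.distrib)
qed

text \<open>If \<open>N\<close> vanished in the field, then \<open>CARD('f) = N * k + 1\<close>
  would be both 0 and 1 there.\<close>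

lemma of_nat_dvd_card_minus_1_nonzero:
  assumes "N dvd CARD('f) - 1"
  shows "(of_nat N :: 'f::{field,finite}) \<noteq> 0"
proof
  assume N: "of_nat N = (0::'f)"
  obtain k where "CARD('f) - 1 = N * k" using assms by (auto elim: dvdE)
  then have "CARD('f) = N * k + 1" using zero_less_card_finite[where 'a='f] by linarith
  then show False using N of_nat_CARD_eq_0[where 'f='f] by simp
qed

text \<open>The left-hand side is, up to the factor \<open>N\<close>, the inverse discrete Fourier transform of the
  product of two Laurent polynomials.\<close>

lemma dft_coeff_mult:
  fixes \<alpha> :: "'f::field"
  assumes "primitive_root_of_unity N \<alpha>" "finite P" "finite Q"
  shows "(\<Sum>n=1..N. (\<alpha> ^ n) powi (- e) *
            ((\<Sum>p\<in>P. f p * (\<alpha> ^ n) powi \<phi> p) * (\<Sum>q\<in>Q. g q * (\<alpha> ^ n) powi \<psi> q)))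
         = of_nat N * (\<Sum>(p, q) | (p, q) \<in> P \<times> Q \<and> int N dvd \<phi> p + \<psi> q - e. f p * g q)"
proof -
  have nz: "\<alpha> ^ n \<noteq> 0" for n using primitive_root_nonzero[OF assms(1)] by simp
  have "(\<Sum>n=1..N. (\<alpha> ^ n) powi (- e) *
            ((\<Sum>p\<in>P. f p * (\<alpha> ^ n) powi \<phi> p) * (\<Sum>q\<in>Q. g q * (\<alpha> ^ n) powi \<psi> q)))
     = (\<Sum>n=1..N. \<Sum>(p, q)\<in>P \<times> Q. f p * g q * (\<alpha> ^ n) powi (\<phi> p + \<psi> q - e))"
  proof (rule sum.cong[OF refl])
    fix n
    show "(\<alpha> ^ n) powi (- e) *
            ((\<Sum>p\<in>P. f p * (\<alpha> ^ n) powi \<phi> p) * (\<Sum>q\<in>Q. g q * (\<alpha> ^ n) powi \<psi> q))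
      = (\<Sum>(p, q)\<in>P \<times> Q. f p * g q * (\<alpha> ^ n) powi (\<phi> p + \<psi> q - e))"
      by (subst sum_product, subst sum.cartesian_product, subst sum_distrib_left, intro sum.cong refl)
         (auto simp: power_int_add[OF disjI1[OF nz]] power_int_minus
           power_int_diff[OF disjI1[OF nz]] divide_inverse mult_ac)
  qed
  also have "\<dots> = (\<Sum>(p, q)\<in>P \<times> Q. f p * g q * (\<Sum>n=1..N. (\<alpha> ^ n) powi (\<phi> p + \<psi> q - e)))"
    by (subst sum.swap) (simp add: sum_distrib_left case_prod_unfold)
  also have "\<dots> = (\<Sum>(p, q)\<in>P \<times> Q. if int N dvd \<phi> p + \<psi> q - e then of_nat N * (f p * g q) else 0)"
    unfolding sum_primitive_root_power_int[OF assms(1)] by (intro sum.cong refl) auto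
  also have "\<dots> = (\<Sum>(p, q) | (p, q) \<in> P \<times> Q \<and> int N dvd \<phi> p + \<psi> q - e. of_nat N * (f p * g q))"
    using assms(2,3) by (intro sum.mono_neutral_cong_right) (auto split: if_splits)
  finally show ?thesis by (simp add: sum_distrib_left case_prod_unfold)
qed

section \<open>Exponents of the product modulo the number of servers\<close>

text \<open>All exponents of the product lie within distance less than \<open>N\<close> of a wanted exponent
  \<open>e\<close>, so reduction modulo \<open>N\<close> causes no collision there, and the four families of cross terms
  can be separated by comparing integers.\<close>

lemma exponents_aligned_iff:
  fixes t s d T i l m j k r i' j' :: nat
  defines "M \<equiv> int t * int s + int T"
  defines "N \<equiv> (int d + 1) * M - int s"
  assumes "0 < s" "0 < T" "i' \<in> {1..t}" "j' \<in> {1..d}"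
  defines "e \<equiv> (int i' - 1) * int s + (1 - int j') * M"
  shows "\<lbrakk>i \<in> {1..t}; l \<in> {1..s}; m \<in> {1..s}; j \<in> {1..d}\<rbrakk> \<Longrightarrow>
      N dvd ((int i - 1) * int s + int l - 1) + ((1 - int j) * M + (1 - int m)) - e
        \<longleftrightarrow> i = i' \<and> j = j' \<and> l = m"
    and "\<lbrakk>k \<in> {1..T}; m \<in> {1..s}; j \<in> {1..d}\<rbrakk> \<Longrightarrow>
      \<not> N dvd (int t * int s + int k - 1) + ((1 - int j) * M + (1 - int m)) - e"
    and "\<lbrakk>i \<in> {1..t}; l \<in> {1..s}; r \<in> {1..T}\<rbrakk> \<Longrightarrow>
      \<not> N dvd ((int i - 1) * int s + int l - 1) + (- int d * M - int r + 1) - e"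
    and "\<lbrakk>k \<in> {1..T}; r \<in> {1..T}\<rbrakk> \<Longrightarrow>
      \<not> N dvd (int t * int s + int k - 1) + (- int d * M - int r + 1) - e"
proof -
  have no_wrap: "N dvd x \<longleftrightarrow> x = 0" if "\<bar>x\<bar> < N" for x
    using that by (metis abs_dvd_iff dvd_0_right dvd_abs_iff linorder_not_le zdvd_imp_le zero_less_abs_iff abs_ge_zero order_le_less_trans)
  \<comment> \<open>Applied with \<open>y = M\<close> and \<open>y = s\<close>, this recovers block
    indices from an equation between exponents.\<close>
  have small_mult: "x = 0" if "\<bar>x * y\<bar> < y" for x y :: int
  proof (rule ccontr)
    assume "x \<noteq> 0"
    then have "1 * \<bar>y\<bar> \<le> \<bar>x\<bar> * \<bar>y\<bar>" by (intro mult_right_mono) auto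
    with that show False by (simp add: abs_mult)
  qed
  have A: "0 \<le> (int i - 1) * int s \<and> (int i - 1) * int s \<le> int t * int s - int s"
    if "i \<in> {1..t}" for i
  proof -
    have "(int i - 1) * int s \<le> (int t - 1) * int s" using that by (intro mult_right_mono) auto
    moreover have "0 \<le> (int i - 1) * int s" using that by (intro mult_nonneg_nonneg) auto
    ultimately show ?thesis by (simp add: algebra_simps)
  qed
  have "0 < M" using \<open>0 < T\<close> by (simp add: M_def add_nonneg_pos)
  have B: "0 \<le> (int j - 1) * M \<and> (int j - 1) * M \<le> int d * M - M"
    if "j \<in> {1..d}" for j
  proof -
    have "(int j - 1) * M \<le> (int d - 1) * M" using that \<open>0 < M\<close> by (intro mult_right_mono) auto
    moreover have "0 \<le> (int j - 1) * M" using that \<open>0 < M\<close> by (intro mult_nonneg_nonneg) auto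
    ultimately show ?thesis by (simp add: algebra_simps)
  qed
  have e: "e = (int i' - 1) * int s - (int j' - 1) * M" by (simp add: e_def algebra_simps)
  have jm: "(1 - int j) * M = - ((int j - 1) * M)" for j by (simp add: algebra_simps)
  have N: "N = int d * M + M - int s" by (simp add: N_def algebra_simps)
  note A' = A[OF \<open>i' \<in> {1..t}\<close>] and B' = B[OF \<open>j' \<in> {1..d}\<close>]
  have M: "M = int t * int s + int T" by (simp add: M_def)
  {
    assume *: "i \<in> {1..t}" "l \<in> {1..s}" "m \<in> {1..s}" "j \<in> {1..d}"
    let ?x = "((int i - 1) * int s + int l - 1) + ((1 - int j) * M + (1 - int m)) - e"
    have "N dvd ?x \<longleftrightarrow> ?x = 0"
      using * A[OF *(1)] B[OF *(4)] A' B' M \<open>0 < T\<close> by (intro no_wrap, unfold e jm N abs_less_iff atLeastAtMost_iff, elim conjE, intro conjI; linarith)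
    also have "\<dots> \<longleftrightarrow> i = i' \<and> j = j' \<and> l = m"
    proof
      assume x: "?x = 0"
      then have eq: "(int j' - int j) * M = (int i' - int i) * int s + int m - int l"
        by (simp add: e algebra_simps)
      also have "(int i' - int i) * int s = (int i' - 1) * int s - (int i - 1) * int s"
        by (simp add: algebra_simps)
      \<comment> \<open>The row terms differ by at most \<open>t * s - s\<close> and
        \<open>l\<close>, \<open>m\<close> by less than \<open>s\<close>, so the right-hand side
        stays below \<open>t * s < M\<close>. Once \<open>j = j'\<close> is known, what is left is a
        multiple of \<open>s\<close> smaller than \<open>s\<close>.\<close>
      finally have "\<bar>(int j' - int j) * M\<bar> < M"
        using * A[OF *(1)] A' M \<open>0 < T\<close>
        by (unfold abs_less_iff atLeastAtMost_iff, elim conjE, intro conjI; linarith)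
      then have j: "j = j'" using small_mult[of "int j' - int j" M] by simp
      then have "(int i' - int i) * int s = int l - int m" using eq by simp
      moreover from this have "i = i'" using small_mult[of "int i' - int i" "int s"] * by auto
      ultimately show "i = i' \<and> j = j' \<and> l = m" using j by simp
    qed (simp add: e algebra_simps)
    finally show "N dvd ?x \<longleftrightarrow> i = i' \<and> j = j' \<and> l = m" .
  }
  {
    assume *: "k \<in> {1..T}" "m \<in> {1..s}" "j \<in> {1..d}"
    let ?x = "(int t * int s + int k - 1) + ((1 - int j) * M + (1 - int m)) - e"
    have "N dvd ?x \<longleftrightarrow> ?x = 0"
      using * B[OF *(3)] A' B' M \<open>0 < T\<close> by (intro no_wrap, unfold e jm N abs_less_iff atLeastAtMost_iff, elim conjE, intro conjI; linarith)
    moreover have "?x \<noteq> 0"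
    proof
      assume "?x = 0"
      then have eq: "(int j - int j') * M = int t * int s + int k - int m - (int i' - 1) * int s"
        by (simp add: e algebra_simps)
      \<comment> \<open>The right-hand side lies between \<open>1\<close> and \<open>M - 1\<close>,
        strictly between two consecutive multiples of \<open>M\<close>.\<close>
      then have "\<bar>(int j - int j') * M\<bar> < M" and "(int j - int j') * M > 0"
        using * A' M by (unfold abs_less_iff atLeastAtMost_iff, elim conjE, (intro conjI)?; linarith)+
      then show False using small_mult[of "int j - int j'" M] by auto
    qed
    ultimately show "\<not> N dvd ?x" by simp
  }
  {
    assume *: "i \<in> {1..t}" "l \<in> {1..s}" "r \<in> {1..T}"
    let ?x = "((int i - 1) * int s + int l - 1) + (- int d * M - int r + 1) - e"
    \<comment> \<open>The difference is negative and at least \<open>1 - N\<close>. The lower bound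
      is attained, at \<open>i = 1\<close>, \<open>l = 1\<close>, \<open>r = T\<close>,
      \<open>i' = t\<close>, \<open>j' = 1\<close>.\<close>
    have "\<bar>?x\<bar> < N" "?x \<noteq> 0"
      using * A[OF *(1)] A' B' M \<open>0 < T\<close>
      by (unfold e N abs_less_iff atLeastAtMost_iff, elim conjE, (intro conjI)?; linarith)+
    then show "\<not> N dvd ?x" using no_wrap by simp
  }
  {
    assume *: "k \<in> {1..T}" "r \<in> {1..T}"
    let ?x = "(int t * int s + int k - 1) + (- int d * M - int r + 1) - e"
    \<comment> \<open>The difference is at most \<open>-1\<close>, because the largest exponent of
      \<open>f_A\<close> is \<open>M - 1\<close>: products of two masks stay just below the wanted
      exponents.\<close>
    have "\<bar>?x\<bar> < N" "?x \<noteq> 0"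
      using * A' B' M \<open>0 < s\<close>
      by (unfold e N abs_less_iff atLeastAtMost_iff, elim conjE, (intro conjI)?; linarith)+
    then show "\<not> N dvd ?x" using no_wrap by simp
  }
qed

text \<open>From \<open>s \<le> t * s\<close> it follows that neither natural-number subtraction
  truncates, so both branches of the definition become one integer formula.\<close>

lemma int_rou_recovery_threshold:
  assumes "0 < t" "0 < s" "0 < d" "0 < T"
  shows "int (rou_recovery_threshold t s d T) = (int d + 1) * (int t * int s + int T) - int s"
proof -
  have "s \<le> t * s" "1 \<le> (d + 1) * (t + T)" using assms by auto
  moreover have "s \<le> d * s * t + d * T + t * s" using \<open>s \<le> t * s\<close> by linarith
  ultimately show ?thesis
    by (auto simp: rou_recovery_threshold_def of_nat_diff algebra_simps)
qed

section \<open>Independence, mutual information and uniform distributions\<close>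

lemma emeasure_pair_pmf:
  "emeasure (pair_pmf P Q) (A \<times> B) = emeasure (measure_pmf P) A * emeasure (measure_pmf Q) B"
proof -
  have "emeasure (pair_pmf P Q) (A \<times> B) = (\<integral>\<^sup>+x. indicator (A \<times> B) x \<partial>pair_pmf P Q)"
    by simp
  also have "\<dots> = (\<integral>\<^sup>+a. \<integral>\<^sup>+b. indicator A a * indicator B b \<partial>Q \<partial>P)"
    by (simp only: nn_integral_pair_pmf' indicator_times fst_conv snd_conv)
  also have "\<dots> = emeasure (measure_pmf P) A * emeasure (measure_pmf Q) B"
    by (simp add: nn_integral_cmult nn_integral_multc)
  finally show ?thesis .
qed

text \<open>Projecting the product law identifies \<open>P\<close> and \<open>Q\<close> as the
  marginals. Mutual information is then the divergence of a probability measure from itself.\<close>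

lemma pmf_mutual_information_eq_0:
  assumes "map_pmf (\<lambda>w. (X w, Y w)) p = pair_pmf P Q"
  shows "pmf_mutual_information p X Y = 0"
proof -
  let ?S = "count_space (range X)" and ?T = "count_space (range Y)"
  let ?J = "distr (measure_pmf p) (?S \<Otimes>\<^sub>M ?T) (\<lambda>w. (X w, Y w))"
  have X: "map_pmf X p = P"
    using arg_cong[OF assms, of "map_pmf fst"] by (simp add: pmf.map_comp o_def map_fst_pair_pmf)
  have Y: "map_pmf Y p = Q"
    using arg_cong[OF assms, of "map_pmf snd"] by (simp add: pmf.map_comp o_def map_snd_pair_pmf)
  have mX[measurable]: "X \<in> measurable (measure_pmf p) ?S"
    and mY[measurable]: "Y \<in> measurable (measure_pmf p) ?T"
    by simp_all
  \<comment> \<open>The product of two discrete sigma-algebras need not be discrete, so the two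
    measures are compared on rectangles only.\<close>
  have prod: "distr (measure_pmf p) ?S X \<Otimes>\<^sub>M distr (measure_pmf p) ?T Y = ?J"
  proof (rule pair_measure_eqI)
    show "sigma_finite_measure (distr (measure_pmf p) ?S X)"
      "sigma_finite_measure (distr (measure_pmf p) ?T Y)"
      by (auto intro!: finite_measure.axioms(1) prob_space.finite_measure
          measure_pmf.prob_space_distr)
  next
    fix A B assume AB: "A \<in> sets (distr (measure_pmf p) ?S X)"
      "B \<in> sets (distr (measure_pmf p) ?T Y)"
    have "emeasure ?J (A \<times> B) = emeasure (map_pmf (\<lambda>w. (X w, Y w)) p) (A \<times> B)"
      unfolding emeasure_map_pmf using AB by (subst emeasure_distr) (auto intro: pair_measureI simp: space_pair_measure)
    also have "\<dots> = emeasure (map_pmf X p) A * emeasure (map_pmf Y p) B"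
      by (simp only: assms emeasure_pair_pmf X Y)
    finally show "emeasure (distr (measure_pmf p) ?S X) A * emeasure (distr (measure_pmf p) ?T Y) B
        = emeasure ?J (A \<times> B)"
      using AB by (simp add: emeasure_distr)
  qed (simp add: sets_pair_measure_cong[OF sets_distr sets_distr])
  interpret J: prob_space ?J
    by (rule measure_pmf.prob_space_distr) measurable
  show ?thesis
    unfolding pmf_mutual_information_def prob_space.mutual_information_def[OF prob_space_measure_pmf] prod
    by (rule J.KL_same_eq_0)
qed

text \<open>The law of \<open>g x y\<close> for fixed \<open>x\<close> is the same for every
  \<open>x\<close> in the support. This is the passage from fixed data \<open>(A, B)\<close> to
  independence from random data.\<close>

lemma map_pair_pmf_snd_const:
  assumes "\<And>x. x \<in> set_pmf P \<Longrightarrow> map_pmf (g x) Q = R"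
  shows "map_pmf (\<lambda>(x, y). (x, g x y)) (pair_pmf P Q) = pair_pmf P R"
proof -
  have "map_pmf (\<lambda>(x, y). (x, g x y)) (pair_pmf P Q)
    = bind_pmf P (\<lambda>x. map_pmf (Pair x) (map_pmf (g x) Q))"
    by (simp add: pair_pmf_def map_bind_pmf map_pmf_def bind_assoc_pmf bind_return_pmf)
  also have "\<dots> = bind_pmf P (\<lambda>x. map_pmf (Pair x) R)"
    using assms by (intro bind_pmf_cong) auto
  also have "\<dots> = pair_pmf P R"
    by (simp add: pair_pmf_def map_pmf_def)
  finally show ?thesis .
qed

lemma finite_carrier_mat: "finite (carrier_mat m n :: 'f::finite mat set)"
proof (rule finite_imageD)
  let ?I = "{..<m} \<times> {..<n}"
  \<comment> \<open>Restricting to the index grid places the entry functions in a finite extensional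
    function space.\<close>
  let ?h = "\<lambda>A :: 'f mat. restrict (\<lambda>ij. A $$ ij) ?I"
  show "finite (?h ` carrier_mat m n)"
    by (rule finite_subset[OF _ finite_PiE[of ?I "\<lambda>_. UNIV"]]) (auto split: if_splits)
  show "inj_on ?h (carrier_mat m n)"
  proof (rule inj_onI)
    fix A B :: "'f mat" assume AB: "A \<in> carrier_mat m n" "B \<in> carrier_mat m n" "?h A = ?h B"
    show "A = B"
    proof (rule eq_matI)
      fix i j assume "i < dim_row B" "j < dim_col B"
      with AB(2) have "(i, j) \<in> ?I" by auto
      then show "A $$ (i, j) = B $$ (i, j)"
        using fun_cong[OF AB(3), of "(i, j)"] by (simp only: restrict_apply if_True)
    qed (use AB in auto)
  qed
qed

lemma carrier_mat_nonempty: "carrier_mat m n \<noteq> {}"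
  using mat_carrier by blast

lemma uniform_masks_eq:
  "(uniform_masks T m n :: (nat \<Rightarrow> 'f::{field,finite} mat) pmf)
     = pmf_of_set ({1..T} \<rightarrow>\<^sub>E carrier_mat m n)"
proof -
  \<comment> \<open>The default value \<open>undefined\<close> is the one that extensional functions
    take outside their domain.\<close>
  have "PiE_dflt {1..T} undefined (\<lambda>_. carrier_mat m n :: 'f mat set) = {1..T} \<rightarrow>\<^sub>E carrier_mat m n"
    by (auto simp: PiE_dflt_def PiE_def extensional_def Pi_def)
  then show ?thesis
    unfolding uniform_masks_def by (simp add: Pi_pmf_of_set finite_carrier_mat carrier_mat_nonempty)
qed

lemma pair_pmf_of_set:
  assumes "finite A" "finite B" "A \<noteq> {}" "B \<noteq> {}"
  shows "pair_pmf (pmf_of_set A) (pmf_of_set B) = pmf_of_set (A \<times> B)"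
proof (rule pmf_eqI)
  fix x show "pmf (pair_pmf (pmf_of_set A) (pmf_of_set B)) x = pmf (pmf_of_set (A \<times> B)) x"
    using assms by (cases x) (auto simp: pmf_pair indicator_def)
qed

text \<open>Two polynomials of degree less than \<open>T\<close> that agree at \<open>T\<close>
  distinct points have the same coefficients.\<close>

lemma vandermonde_inj:
  fixes x :: "'i \<Rightarrow> 'f::field"
  assumes "finite C" "card C = T" "inj_on x C"
    and "\<And>i. i \<in> C \<Longrightarrow> (\<Sum>k=1..T. r k * x i ^ (k - 1)) = (\<Sum>k=1..T. r' k * x i ^ (k - 1))"
    and "k \<in> {1..T}"
  shows "r k = r' k"
proof -
  define P where "P r = (\<Sum>k<T. monom (r (Suc k)) k)" for r :: "nat \<Rightarrow> 'f"
  have coeff: "poly.coeff (P r) n = (if n < T then r (Suc n) else 0)" for r n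
    by (auto simp: P_def coeff_sum)
  \<comment> \<open>The index \<open>k\<close> in \<open>{1..T}\<close> makes \<open>T\<close>
    positive, which the strict bound requires even for the zero polynomial.\<close>
  have deg: "degree (P r) < T" for r
  proof -
    have "degree (P r) \<le> T - 1" by (rule degree_le) (auto simp: coeff)
    then show ?thesis using assms(5) by auto
  qed
  have poly: "poly (P r) z = (\<Sum>k=1..T. r k * z ^ (k - 1))" for r z
    by (simp add: P_def poly_sum poly_monom sum.atLeast1_atMost_eq)
  have "P r = P r'"
    by (rule poly_eqI_degree[of "x ` C"])
      (use assms deg in \<open>auto simp: poly card_image\<close>)
  moreover have "Suc (k - 1) = k" "k - 1 < T" using assms(5) by auto
  ultimately show ?thesis using coeff[of r "k - 1"] coeff[of r' "k - 1"] by simp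
qed

section \<open>Share polynomials as single sums over all their terms\<close>

text \<open>The terms of the share polynomials are indexed by \<open>Inl (i, j)\<close> for the data block
  \<open>(i, j)\<close> and by \<open>Inr k\<close> for the \<open>k\<close>-th mask.\<close>

definition exponent_A :: "nat \<Rightarrow> nat \<Rightarrow> (nat \<times> nat) + nat \<Rightarrow> int" where
  "exponent_A t s = case_sum (\<lambda>(i, j). (int i - 1) * int s + int j - 1)
                             (\<lambda>k. int t * int s + int k - 1)"

definition exponent_B :: "nat \<Rightarrow> nat \<Rightarrow> nat \<Rightarrow> nat \<Rightarrow> (nat \<times> nat) + nat \<Rightarrow> int" where
  "exponent_B t s d T = case_sum (\<lambda>(i, j). (1 - int j) * (int t * int s + int T) + (1 - int i))
                                 (\<lambda>k. - int d * (int t * int s + int T) - int k + 1)"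

definition share_coeff ::
  "nat \<Rightarrow> nat \<Rightarrow> 'f mat \<Rightarrow> (nat \<Rightarrow> 'f mat) \<Rightarrow> nat \<times> nat \<Rightarrow> (nat \<times> nat) + nat \<Rightarrow> 'f" where
  "share_coeff p q A R uv = case_sum (\<lambda>(i, j). grid_block p q A i j $$ uv) (\<lambda>k. R k $$ uv)"

text \<open>Data and mask terms are merged into one sum over a disjoint union, the form to which
  \<open>dft_coeff_mult\<close> applies.\<close>

lemma f_A_index:
  assumes "u < dim_row A div t" "v < dim_col A div s"
  shows "f_A t s T A R x $$ (u, v)
    = (\<Sum>p\<in>({1..t} \<times> {1..s}) <+> {1..T}. share_coeff t s A R (u, v) p * x powi exponent_A t s p)"
proof -
  have *: "f_A t s T A R x $$ (u, v) = (\<Sum>i=1..t. \<Sum>j=1..s.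
          grid_block t s A i j $$ (u, v) * x powi ((int i - 1) * int s + int j - 1))
     + (\<Sum>k=1..T. R k $$ (u, v) * x powi (int t * int s + int k - 1))"
    using assms by (simp add: f_A_def)
  show ?thesis unfolding *
    by (simp add: sum.Plus sum.cartesian_product share_coeff_def exponent_A_def case_prod_unfold)
qed

lemma f_B_index:
  assumes "u < dim_row B div s" "v < dim_col B div d"
  shows "f_B t s d T B S x $$ (u, v)
    = (\<Sum>p\<in>({1..s} \<times> {1..d}) <+> {1..T}. share_coeff s d B S (u, v) p * x powi exponent_B t s d T p)"
proof -
  have *: "f_B t s d T B S x $$ (u, v) = (\<Sum>i=1..s. \<Sum>j=1..d. grid_block s d B i j $$ (u, v)
            * x powi ((1 - int j) * (int t * int s + int T) + (1 - int i)))
     + (\<Sum>k=1..T. S k $$ (u, v) * x powi (- int d * (int t * int s + int T) - int k + 1))"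
    using assms by (simp add: f_B_def)
  show ?thesis unfolding *
    by (simp add: sum.Plus sum.cartesian_product share_coeff_def exponent_B_def case_prod_unfold)
qed

lemma f_A_carrier: "A \<in> carrier_mat a b \<Longrightarrow> f_A t s T A R x \<in> carrier_mat (a div t) (b div s)"
  by (auto simp: f_A_def)

lemma f_B_carrier: "B \<in> carrier_mat b c \<Longrightarrow> f_B t s d T B S x \<in> carrier_mat (b div s) (c div d)"
  by (auto simp: f_B_def)

text \<open>The four cases of \<open>exponents_aligned_iff\<close> combined: every pair involving a
  mask drops out, and the surviving pairs are exactly the summands of block \<open>(i, j)\<close> of
  the product.\<close>

lemma aligned_pairs:
  assumes "0 < t" "0 < d" "0 < s" "0 < T" "i \<in> {1..t}" "j \<in> {1..d}"
    and "e = (int i - 1) * int s + (1 - int j) * (int t * int s + int T)"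
  shows "{(p, q). (p, q) \<in> (({1..t} \<times> {1..s}) <+> {1..T}) \<times> (({1..s} \<times> {1..d}) <+> {1..T})
            \<and> int (rou_recovery_threshold t s d T) dvd exponent_A t s p + exponent_B t s d T q - e}
         = (\<lambda>l. (Inl (i, l), Inl (l, j))) ` {1..s}"
    (is "?L = ?R")
proof -
  note aligned = exponents_aligned_iff[OF assms(3,4,5,6), folded assms(7)]
  note N = int_rou_recovery_threshold[OF assms(1,3,2,4)]
  show ?thesis
  proof (rule Set.set_eqI)
    fix x :: "((nat \<times> nat) + nat) \<times> ((nat \<times> nat) + nat)"
    obtain p q where x: "x = (p, q)" by (cases x)
    show "x \<in> ?L \<longleftrightarrow> x \<in> ?R"
    proof (cases p; cases q)
      fix il mj assume "p = Inl il" "q = Inl mj"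
      moreover obtain i' l m j' where "il = (i', l)" "mj = (m, j')" by (cases il; cases mj)
      ultimately show ?thesis
        using aligned(1)[of i' l m j'] assms(5,6)
        by (auto simp: x N exponent_A_def exponent_B_def)
    next
      fix k mj assume "p = Inr k" "q = Inl mj"
      moreover obtain m j' where "mj = (m, j')" by (cases mj)
      ultimately show ?thesis
        using aligned(2)[of k m j'] by (auto simp: x N exponent_A_def exponent_B_def)
    next
      fix il r assume "p = Inl il" "q = Inr r"
      moreover obtain i' l where "il = (i', l)" by (cases il)
      ultimately show ?thesis
        using aligned(3)[of i' l r] by (auto simp: x N exponent_A_def exponent_B_def)
    next
      fix k r assume "p = Inr k" "q = Inr r"
      then show ?thesis
        using aligned(4)[of k r] by (auto simp: x N exponent_A_def exponent_B_def)
    qed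
  qed
qed

section \<open>Block multiplication and decoding\<close>

lemma block_index_less:
  assumes "p dvd n" "i \<in> {1..p}" "u < n div p"
  shows "(i - 1) * (n div p) + u < (n::nat)"
proof -
  have "(i - 1) * (n div p) + u < (i - 1) * (n div p) + n div p" using assms by simp
  also have "\<dots> = i * (n div p)" using assms(2) by (cases i) auto
  also have "\<dots> \<le> p * (n div p)" using assms(2) by (intro mult_right_mono) auto
  finally show ?thesis using assms(1) by simp
qed

lemma grid_block_index:
  "u < dim_row M div p \<Longrightarrow> v < dim_col M div q \<Longrightarrow>
    grid_block p q M i j $$ (u, v) = M $$ ((i - 1) * (dim_row M div p) + u, (j - 1) * (dim_col M div q) + v)"
  by (simp add: grid_block_def Let_def)

text \<open>The inner summation range of length \<open>b\<close> is cut into \<open>s\<close>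
  consecutive runs of length \<open>b div s\<close>, one for each \<open>l\<close>.\<close>

lemma mult_index_grid_blocks:
  fixes A B :: "'f::semiring_0 mat"
  assumes "A \<in> carrier_mat a b" "B \<in> carrier_mat b c" "t dvd a" "s dvd b" "d dvd c"
    and "i \<in> {1..t}" "j \<in> {1..d}" "u < a div t" "v < c div d"
  shows "(A * B) $$ ((i - 1) * (a div t) + u, (j - 1) * (c div d) + v)
    = (\<Sum>l=1..s. \<Sum>w<b div s. grid_block t s A i l $$ (u, w) * grid_block s d B l j $$ (w, v))"
proof -
  let ?h = "b div s" and ?p = "(i - 1) * (a div t) + u" and ?q = "(j - 1) * (c div d) + v"
  have pq: "?p < a" "?q < c"
    using assms block_index_less by blast+
  have "(A * B) $$ (?p, ?q) = (\<Sum>k<s * ?h. A $$ (?p, k) * B $$ (k, ?q))"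
    using assms pq by (auto simp: scalar_prod_def atLeast0LessThan intro!: sum.cong)
  also have "\<dots> = (\<Sum>l<s. \<Sum>k=l * ?h..<l * ?h + ?h. A $$ (?p, k) * B $$ (k, ?q))"
    by (rule sum.nat_group[symmetric])
  also have "\<dots> = (\<Sum>l<s. \<Sum>w<?h. A $$ (?p, l * ?h + w) * B $$ (l * ?h + w, ?q))"
  proof (rule sum.cong[OF refl])
    fix l
    show "(\<Sum>k=l * ?h..<l * ?h + ?h. A $$ (?p, k) * B $$ (k, ?q))
        = (\<Sum>w<?h. A $$ (?p, l * ?h + w) * B $$ (l * ?h + w, ?q))"
      by (rule sum.reindex_bij_witness[of _ "\<lambda>w. l * ?h + w" "\<lambda>k. k - l * ?h"]) auto
  qed
  also have "\<dots> = (\<Sum>l=1..s. \<Sum>w<?h. A $$ (?p, (l - 1) * ?h + w) * B $$ ((l - 1) * ?h + w, ?q))"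
    by (simp add: sum.atLeast1_atMost_eq)
  also have "\<dots> = (\<Sum>l=1..s. \<Sum>w<?h. grid_block t s A i l $$ (u, w) * grid_block s d B l j $$ (w, v))"
    using assms by (intro sum.cong refl) (auto simp: grid_block_index)
  finally show ?thesis .
qed

text \<open>An entry of a response is a sum over \<open>w\<close> of products of two scalar Laurent
  polynomials. The transform is linear, so it acts on each product separately, where
  \<open>dft_coeff_mult\<close> and \<open>aligned_pairs\<close> evaluate it.\<close>

lemma rou_dft_response:
  fixes A B :: "'f::field mat"
  assumes "0 < t" "0 < d" "0 < s" "0 < T" "t dvd a" "s dvd b" "d dvd c"
    and "N = rou_recovery_threshold t s d T" "primitive_root_of_unity N \<alpha>"
    and A: "A \<in> carrier_mat a b" and B: "B \<in> carrier_mat b c"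
    and "i \<in> {1..t}" "j \<in> {1..d}" and uv: "u < a div t" "v < c div d"
  defines "e \<equiv> (int i - 1) * int s + (1 - int j) * (int t * int s + int T)"
  shows "(\<Sum>n=1..N. (\<alpha> ^ n) powi (- e)
             * (f_A t s T A R (\<alpha> ^ n) * f_B t s d T B S (\<alpha> ^ n)) $$ (u, v))
    = of_nat N * (A * B) $$ ((i - 1) * (a div t) + u, (j - 1) * (c div d) + v)"
proof -
  let ?h = "b div s"
  let ?P = "({1..t} \<times> {1..s}) <+> {1..T}" and ?Q = "({1..s} \<times> {1..d}) <+> {1..T}"
  have dims: "dim_row A = a" "dim_col A = b" "dim_row B = b" "dim_col B = c" using A B by auto
  have "(f_A t s T A R x * f_B t s d T B S x) $$ (u, v)
      = (\<Sum>w<?h. (\<Sum>p\<in>?P. share_coeff t s A R (u, w) p * x powi exponent_A t s p)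
              * (\<Sum>q\<in>?Q. share_coeff s d B S (w, v) q * x powi exponent_B t s d T q))" for x
    using uv f_A_carrier[OF A, of t s T R x] f_B_carrier[OF B, of t s d T S x]
    by (auto simp: scalar_prod_def atLeast0LessThan f_A_index f_B_index dims intro!: sum.cong)
  then have "(\<Sum>n=1..N. (\<alpha> ^ n) powi (- e)
             * (f_A t s T A R (\<alpha> ^ n) * f_B t s d T B S (\<alpha> ^ n)) $$ (u, v))
    = (\<Sum>w<?h. \<Sum>n=1..N. (\<alpha> ^ n) powi (- e) *
         ((\<Sum>p\<in>?P. share_coeff t s A R (u, w) p * (\<alpha> ^ n) powi exponent_A t s p)
              * (\<Sum>q\<in>?Q. share_coeff s d B S (w, v) q * (\<alpha> ^ n) powi exponent_B t s d T q)))"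
    by (subst sum.swap) (simp add: sum_distrib_left)
  also have "\<dots> = (\<Sum>w<?h. of_nat N *
      (\<Sum>l=1..s. grid_block t s A i l $$ (u, w) * grid_block s d B l j $$ (w, v)))"
  proof (intro sum.cong refl)
    fix w
    show "(\<Sum>n=1..N. (\<alpha> ^ n) powi (- e) *
         ((\<Sum>p\<in>?P. share_coeff t s A R (u, w) p * (\<alpha> ^ n) powi exponent_A t s p)
              * (\<Sum>q\<in>?Q. share_coeff s d B S (w, v) q * (\<alpha> ^ n) powi exponent_B t s d T q)))
      = of_nat N * (\<Sum>l=1..s. grid_block t s A i l $$ (u, w) * grid_block s d B l j $$ (w, v))"
      unfolding assms(8)
      by (subst dft_coeff_mult, use assms(8,9) in simp, simp, simp,
          subst aligned_pairs[OF assms(1-4) \<open>i \<in> {1..t}\<close> \<open>j \<in> {1..d}\<close>])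
        (simp_all add: e_def sum.reindex inj_on_def share_coeff_def)
  qed
  also have "\<dots> = of_nat N * (A * B) $$ ((i - 1) * (a div t) + u, (j - 1) * (c div d) + v)"
    unfolding sum_distrib_left[symmetric]
    by (subst mult_index_grid_blocks[OF A B, of t s d]) (use assms in \<open>auto intro: sum.swap\<close>)
  finally show ?thesis .
qed

lemma rou_decodable_threshold:
  fixes \<alpha> :: "'f::{field,finite}"
  assumes "0 < t" "0 < d" "0 < s" "0 < T" "t dvd a" "s dvd b" "d dvd c"
    and N: "N = rou_recovery_threshold t s d T" "N dvd CARD('f) - 1"
    and \<alpha>: "primitive_root_of_unity N \<alpha>"
  shows "rou_decodable a b c t s d T N \<alpha>"
proof -
  let ?e = "\<lambda>i j. int i * int s - int j * (int t * int s + int T)"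
  let ?ha = "a div t" and ?hc = "c div d"
  \<comment> \<open>Entry \<open>(p, q)\<close> lies in the block with zero-based index
    \<open>(p div ?ha, q div ?hc)\<close>, at the position given by the remainders;
    \<open>?e\<close> is the wanted exponent in zero-based indices. The response of Server
    \<open>n\<close> stands at list position \<open>n - 1\<close>.\<close>
  define dec where "dec Y = mat a c (\<lambda>(p, q). inverse (of_nat N) *
      (\<Sum>n=1..N. (\<alpha> ^ n) powi (- ?e (p div ?ha) (q div ?hc)) * (Y ! (n - 1)) $$ (p mod ?ha, q mod ?hc)))"
    for Y :: "'f mat list"
  have "A * B = dec (map (\<lambda>i. f_A t s T A R (\<alpha> ^ i) * f_B t s d T B S (\<alpha> ^ i)) [1..<N + 1])"
    if A: "A \<in> carrier_mat a b" and B: "B \<in> carrier_mat b c" for A B R S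
  proof (rule eq_matI)
    let ?Y = "map (\<lambda>i. f_A t s T A R (\<alpha> ^ i) * f_B t s d T B S (\<alpha> ^ i)) [1..<N + 1]"
    fix p q assume "p < dim_row (dec ?Y)" "q < dim_col (dec ?Y)"
    then have pq: "p < a" "q < c" by (auto simp: dec_def)
    have ht: "a = t * ?ha" "c = d * ?hc" using assms by auto
    \<comment> \<open>The existence of an entry \<open>(p, q)\<close> forces the blocks to be
      nonempty.\<close>
    have pos: "0 < ?ha" "0 < ?hc" using pq ht by (metis gr0I less_nat_zero_code mult_0_right)+
    define i j where "i = p div ?ha + 1" and "j = q div ?hc + 1"
    have ij: "i \<in> {1..t}" "j \<in> {1..d}"
      using pq ht pos by (auto simp: i_def j_def less_mult_imp_div_less Suc_le_eq)
    have nth: "?Y ! (n - 1) = f_A t s T A R (\<alpha> ^ n) * f_B t s d T B S (\<alpha> ^ n)"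
      if "n \<in> {1..N}" for n
      using that by (subst nth_map) (auto simp del: upt_Suc)
    have e: "?e (p div ?ha) (q div ?hc)
        = (int i - 1) * int s + (1 - int j) * (int t * int s + int T)"
      by (simp add: i_def j_def)
    have "dec ?Y $$ (p, q) = inverse (of_nat N) * (\<Sum>n=1..N. (\<alpha> ^ n) powi
          (- ((int i - 1) * int s + (1 - int j) * (int t * int s + int T)))
        * (f_A t s T A R (\<alpha> ^ n) * f_B t s d T B S (\<alpha> ^ n)) $$ (p mod ?ha, q mod ?hc))"
      unfolding dec_def index_mat(1)[OF pq] prod.case e
      by (intro arg_cong2[of _ _ _ _ "(*)"] sum.cong refl) (simp only: nth)
    also have "\<dots> = inverse (of_nat N) * (of_nat N * (A * B) $$ (p, q))"
    proof -
      have "(i - 1) * ?ha + p mod ?ha = p" "(j - 1) * ?hc + q mod ?hc = q"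
        unfolding i_def j_def add_diff_cancel_right' by (rule div_mult_mod_eq)+
      then show ?thesis
        using pos by (subst rou_dft_response[OF assms(1-7) N(1) \<alpha> A B ij]) simp_all
    qed
    also have "\<dots> = (A * B) $$ (p, q)"
      using of_nat_dvd_card_minus_1_nonzero[OF N(2)] by simp
    finally show "(A * B) $$ (p, q) = dec ?Y $$ (p, q)" by simp
  qed (use A B in \<open>auto simp: dec_def\<close>)
  then show ?thesis unfolding rou_decodable_def by blast
qed

section \<open>Uniformity of the shares and security\<close>

text \<open>Equal powers at \<open>m < n\<close> would give \<open>\<alpha> ^ (n - m) = 1\<close>
  with \<open>0 < n - m < N\<close>.\<close>

lemma inj_on_primitive_root_power:
  fixes \<alpha> :: "'f::field"
  assumes "primitive_root_of_unity N \<alpha>"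
  shows "inj_on (\<lambda>n. \<alpha> ^ n) {1..N}"
proof (rule linorder_inj_onI)
  fix m n assume mn: "m < n" "m \<in> {1..N}" "n \<in> {1..N}"
  have "\<alpha> ^ n = \<alpha> ^ m * \<alpha> ^ (n - m)" using mn by (simp flip: power_add)
  moreover have "\<alpha> ^ (n - m) \<noteq> 1"
    using assms mn by (auto simp: primitive_root_of_unity_def)
  ultimately show "\<alpha> ^ m \<noteq> \<alpha> ^ n"
    using primitive_root_nonzero[OF assms] by simp
qed auto

text \<open>Every matrix position \<open>(u, v)\<close> poses its own scalar interpolation problem,
  solved by \<open>vandermonde_inj\<close>.\<close>

lemma masks_determined:
  fixes R R' :: "nat \<Rightarrow> 'f::field mat"
  assumes "finite C" "card C = T" "inj_on x C"
    and R: "R \<in> {1..T} \<rightarrow>\<^sub>E carrier_mat m n" "R' \<in> {1..T} \<rightarrow>\<^sub>E carrier_mat m n"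
    and eq: "\<And>i u v. i \<in> C \<Longrightarrow> u < m \<Longrightarrow> v < n \<Longrightarrow>
      (\<Sum>k=1..T. R k $$ (u, v) * x i ^ (k - 1)) = (\<Sum>k=1..T. R' k $$ (u, v) * x i ^ (k - 1))"
  shows "R = R'"
proof (rule PiE_ext[OF R])
  fix k assume k: "k \<in> {1..T}"
  have "R k \<in> carrier_mat m n" "R' k \<in> carrier_mat m n" using R k by blast+
  then show "R k = R' k"
    using vandermonde_inj[OF assms(1-3) eq k] by (intro eq_matI) auto
qed

text \<open>Injectivity is interpolation: the data terms are fixed and cancel. Surjectivity is
  counting: because \<open>card C = T\<close>, both sides have \<open>(card K * card L) ^ T\<close>
  elements.\<close>

lemma shares_bij_betw:
  fixes \<alpha> :: "'f::{field,finite}" and t s d T :: nat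
  assumes \<alpha>: "primitive_root_of_unity N \<alpha>" and C: "C \<subseteq> {1..N}" "card C = T"
    and A: "A \<in> carrier_mat a b" and B: "B \<in> carrier_mat b c"
  defines "K \<equiv> carrier_mat (a div t) (b div s)" and "L \<equiv> carrier_mat (b div s) (c div d)"
  shows "bij_betw (\<lambda>(R, S). \<lambda>i\<in>C. (f_A t s T A R (\<alpha> ^ i), f_B t s d T B S (\<alpha> ^ i)))
    (({1..T} \<rightarrow>\<^sub>E K) \<times> ({1..T} \<rightarrow>\<^sub>E L)) (C \<rightarrow>\<^sub>E K \<times> L)"
proof -
  let ?G = "\<lambda>(R, S). \<lambda>i\<in>C. (f_A t s T A R (\<alpha> ^ i), f_B t s d T B S (\<alpha> ^ i))"
  let ?X = "({1..T} \<rightarrow>\<^sub>E K) \<times> ({1..T} \<rightarrow>\<^sub>E L)" and ?Y = "C \<rightarrow>\<^sub>E K \<times> L"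
  have nz: "\<alpha> ^ i \<noteq> 0" for i using primitive_root_nonzero[OF \<alpha>] by simp
  have nz_powi: "(\<alpha> ^ i) powi e \<noteq> 0" for i e
    using nz[of i] by (simp only: power_int_eq_0_iff) simp
  have finC: "finite C" using C finite_subset by blast
  have inj1: "inj_on (\<lambda>i. \<alpha> ^ i) C"
    using inj_on_primitive_root_power[OF \<alpha>] C(1) by (rule inj_on_subset)
  \<comment> \<open>The mask exponents of \<open>f_B\<close> decrease with \<open>k\<close>, so its
    Vandermonde system has the inverse powers as nodes.\<close>
  then have inj2: "inj_on (\<lambda>i. inverse (\<alpha> ^ i)) C"
    by (auto simp: inj_on_def)
  have dims: "dim_row A = a" "dim_col A = b" "dim_row B = b" "dim_col B = c" using A B by auto
  have fin: "finite K" "finite L" by (auto simp: K_def L_def finite_carrier_mat)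
  have "inj_on ?G ?X"
  proof (rule inj_onI)
    fix RS RS' assume RS: "RS \<in> ?X" "RS' \<in> ?X" "?G RS = ?G RS'"
    then obtain R S R' S' where RS_eq: "RS = (R, S)" "RS' = (R', S')"
      and R: "R \<in> {1..T} \<rightarrow>\<^sub>E K" "R' \<in> {1..T} \<rightarrow>\<^sub>E K" and S: "S \<in> {1..T} \<rightarrow>\<^sub>E L" "S' \<in> {1..T} \<rightarrow>\<^sub>E L"
      by blast
    have eq: "(\<lambda>i\<in>C. (f_A t s T A R (\<alpha> ^ i), f_B t s d T B S (\<alpha> ^ i)))
             = (\<lambda>i\<in>C. (f_A t s T A R' (\<alpha> ^ i), f_B t s d T B S' (\<alpha> ^ i)))"
      using RS(3) by (simp only: RS_eq prod.case)
    have eqs: "f_A t s T A R (\<alpha> ^ i) = f_A t s T A R' (\<alpha> ^ i)"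
      "f_B t s d T B S (\<alpha> ^ i) = f_B t s d T B S' (\<alpha> ^ i)" if "i \<in> C" for i
      using fun_cong[OF eq, of i] that by auto
    have "R = R'"
    proof (rule masks_determined[OF finC C(2) inj1 R[unfolded K_def]])
      fix i u v assume *: "i \<in> C" "u < a div t" "v < b div s"
      let ?x = "\<alpha> ^ i"
      \<comment> \<open>The nonzero factor common to all mask terms is split off, leaving the
        exponents \<open>0\<close> to \<open>T - 1\<close> of a Vandermonde system.\<close>
      have "?x powi (int t * int s + int k - 1) = ?x powi (int t * int s) * ?x ^ (k - 1)"
        if "k \<in> {1..T}" for k
      proof -
        have "int t * int s + int k - 1 = int t * int s + int (k - 1)"
          using that by (simp add: of_nat_diff)
        then show ?thesis by (simp only: power_int_add[OF disjI1[OF nz]] power_int_of_nat)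
      qed
      then have "?x powi (int t * int s) * (\<Sum>k=1..T. R k $$ (u, v) * ?x ^ (k - 1))
          = ?x powi (int t * int s) * (\<Sum>k=1..T. R' k $$ (u, v) * ?x ^ (k - 1))"
        using arg_cong[OF eqs(1)[OF *(1)], of "\<lambda>M. M $$ (u, v)"] *
        by (simp add: f_A_def dims sum_distrib_left mult_ac)
      then show "(\<Sum>k=1..T. R k $$ (u, v) * ?x ^ (k - 1)) = (\<Sum>k=1..T. R' k $$ (u, v) * ?x ^ (k - 1))"
        using mult_left_cancel[OF nz_powi] by blast
    qed
    moreover have "S = S'"
    proof (rule masks_determined[OF finC C(2) inj2 S[unfolded L_def]])
      fix i u v assume *: "i \<in> C" "u < b div s" "v < c div d"
      let ?x = "\<alpha> ^ i" and ?m = "- int d * (int t * int s + int T)"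
      have "?x powi (?m - int k + 1) = ?x powi ?m * inverse ?x ^ (k - 1)"
        if "k \<in> {1..T}" for k
      proof -
        have "?m - int k + 1 = ?m + - int (k - 1)"
          using that by (simp add: of_nat_diff)
        then show ?thesis
          by (simp only: power_int_add[OF disjI1[OF nz]] power_int_minus power_int_of_nat power_inverse)
      qed
      then have "?x powi ?m * (\<Sum>k=1..T. S k $$ (u, v) * inverse ?x ^ (k - 1))
          = ?x powi ?m * (\<Sum>k=1..T. S' k $$ (u, v) * inverse ?x ^ (k - 1))"
        using arg_cong[OF eqs(2)[OF *(1)], of "\<lambda>M. M $$ (u, v)"] *
        by (simp add: f_B_def dims sum_distrib_left mult_ac)
      then show "(\<Sum>k=1..T. S k $$ (u, v) * inverse ?x ^ (k - 1))
          = (\<Sum>k=1..T. S' k $$ (u, v) * inverse ?x ^ (k - 1))"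
        using mult_left_cancel[OF nz_powi] by blast
    qed
    ultimately show "RS = RS'" by (simp add: RS_eq)
  qed
  moreover have "?G ` ?X \<subseteq> ?Y"
    using f_A_carrier[OF A] f_B_carrier[OF B] by (auto simp: K_def L_def)
  moreover have "card ?X = card ?Y"
    using finC by (simp add: card_PiE card_cartesian_product C(2) power_mult_distrib)
  moreover have "finite ?Y" using finC fin by (auto intro!: finite_PiE)
  ultimately have "?G ` ?X = ?Y"
    by (intro card_subset_eq) (simp_all add: card_image)
  then show ?thesis using \<open>inj_on ?G ?X\<close> by (simp add: bij_betw_def)
qed

lemma rou_secure_primitive_root:
  fixes \<alpha> :: "'f::{field,finite}"
  assumes "primitive_root_of_unity N \<alpha>"
  shows "rou_secure a b c t s d T N \<alpha>"
  unfolding rou_secure_def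
proof (intro allI impI)
  fix P :: "('f mat \<times> 'f mat) pmf" and C
  assume P: "set_pmf P \<subseteq> carrier_mat a b \<times> carrier_mat b c" and C: "C \<subseteq> {1..N}" "card C = T"
  let ?K = "carrier_mat (a div t) (b div s) :: 'f mat set"
  let ?L = "carrier_mat (b div s) (c div d) :: 'f mat set"
  let ?X = "({1..T} \<rightarrow>\<^sub>E ?K) \<times> ({1..T} \<rightarrow>\<^sub>E ?L)"
  let ?g = "\<lambda>(A, B) (R, S). \<lambda>i\<in>C. (f_A t s T A R (\<alpha> ^ i), f_B t s d T B S (\<alpha> ^ i))"
  let ?Q = "pair_pmf (uniform_masks T (a div t) (b div s)) (uniform_masks T (b div s) (c div d))
    :: ((nat \<Rightarrow> 'f mat) \<times> (nat \<Rightarrow> 'f mat)) pmf"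
  have ne: "({1..T} \<rightarrow>\<^sub>E ?K) \<noteq> {}" "({1..T} \<rightarrow>\<^sub>E ?L) \<noteq> {}"
    by (auto simp: PiE_eq_empty_iff carrier_mat_nonempty)
  have fin: "finite ({1..T} \<rightarrow>\<^sub>E ?K)" "finite ({1..T} \<rightarrow>\<^sub>E ?L)"
    by (auto intro!: finite_PiE finite_carrier_mat)
  have Q: "?Q = pmf_of_set ?X"
    unfolding uniform_masks_eq by (rule pair_pmf_of_set[OF fin ne])
  \<comment> \<open>A bijection carries the uniform law to the uniform law, here on a set that
    depends on the dimensions but not on \<open>AB\<close>.\<close>
  have "map_pmf (?g AB) ?Q = pmf_of_set (C \<rightarrow>\<^sub>E ?K \<times> ?L)" if "AB \<in> set_pmf P" for AB
  proof -
    have "AB \<in> carrier_mat a b \<times> carrier_mat b c" using P that by blast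
    then obtain A B where AB: "AB = (A, B)" "A \<in> carrier_mat a b" "B \<in> carrier_mat b c"
      by (rule SigmaE)
    show ?thesis
      unfolding Q AB(1) prod.case
      by (rule map_pmf_of_set_bij_betw[OF shares_bij_betw[OF assms C AB(2,3)]])
        (use ne fin in auto)
  qed
  then have "map_pmf (\<lambda>(AB, RS). (AB, ?g AB RS)) (pair_pmf P ?Q)
      = pair_pmf P (pmf_of_set (C \<rightarrow>\<^sub>E ?K \<times> ?L))"
    by (rule map_pair_pmf_snd_const)
  then show "pmf_mutual_information (rou_experiment a b c t s d T P)
           (\<lambda>((A, B), (R, S)). (A, B))
           (\<lambda>((A, B), (R, S)). \<lambda>i\<in>C. (f_A t s T A R (\<alpha> ^ i), f_B t s d T B S (\<alpha> ^ i))) = 0"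
    unfolding rou_experiment_def
    by (intro pmf_mutual_information_eq_0) (simp add: case_prod_unfold)
qed

section \<open>The inner and outer product partitions\<close>

theorem theorem2:
  fixes t d s T a b c N :: nat
    and \<alpha> :: "'f::{field,finite}"
  assumes "0 < t" "0 < d" "0 < s" "0 < T"
    and "0 < a" "0 < b" "0 < c"
    and "t dvd a" "s dvd b" "d dvd c"
    and "N = rou_recovery_threshold t s d T"
    and "N dvd CARD('f) - 1"
    and "primitive_root_of_unity N \<alpha>"
  shows "(t = 1 \<and> d = 1 \<longrightarrow>
            rou_recovery_threshold t s d T = s + 2 * T
          \<and> rou_decodable a b c t s d T (s + 2 * T) \<alpha>
          \<and> rou_secure a b c t s d T (s + 2 * T) \<alpha>
          \<and> rou_recovery_threshold t s d T = dft_recovery_threshold s T)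
       \<and> (s = 1 \<longrightarrow>
            rou_recovery_threshold t s d T = (d + 1) * (t + T) - 1
          \<and> rou_decodable a b c t s d T ((d + 1) * (t + T) - 1) \<alpha>
          \<and> rou_secure a b c t s d T ((d + 1) * (t + T) - 1) \<alpha>
          \<and> (T < t \<longrightarrow> rou_recovery_threshold t s d T = gasp_recovery_threshold t d T))"
proof -
  have "rou_decodable a b c t s d T N \<alpha>"
    by (rule rou_decodable_threshold) (rule assms)+
  moreover have "rou_secure a b c t s d T N \<alpha>"
    by (rule rou_secure_primitive_root) (rule assms)
  \<comment> \<open>Both branches of the threshold meet here: \<open>2 * (1 + T) - 1\<close> for
    \<open>s = 1\<close>, and \<open>s + T + s - s + T\<close> otherwise.\<close>
  moreover have "N = s + 2 * T" if "t = 1" "d = 1"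
    using that assms(11) by (auto simp: rou_recovery_threshold_def)
  moreover have "N = (d + 1) * (t + T) - 1" if "s = 1"
    using that assms(11) by (simp add: rou_recovery_threshold_def)
  ultimately show ?thesis
    using assms(11) by (auto simp: dft_recovery_threshold_def gasp_recovery_threshold_def)
qed

end
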